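(* Let $m,d\geq1$. If $x^m-1$ divides $M_d(x)$, then $m$ divides $\varphi(d)$, where $\varphi$ is Euler's totient function.
   Context: $M_d(x)=\frac1d\sum_{e\mid d}\mu(e)x^{d/e}\in\mathbb{Q}[x]$ is the $d$th necklace polynomial, $\mu$ the Möbius function. *)

theory Defs
  imports
    "HOL-Number_Theory.Number_Theory"
    "HOL-Computational_Algebra.Computational_Algebra"
begin

definition moebius_mu :: "nat \<Rightarrow> int" where
  "moebius_mu n = (if squarefree n then (-1) ^ card (prime_factors n) else 0)"

definition necklace_poly :: "nat \<Rightarrow> rat poly" where
  "necklace_poly d =
     smult (1 / of_nat d) (\<Sum>e | e dvd d. monom (of_int (moebius_mu e)) (d div e))"

end

theory Submission
  imports Defs
begin

text \<open>
  Modulo \<open>x ^ m - 1\<close> every exponent may be reduced modulo \<open>m\<close>. If \<open>x ^ m - 1\<close> divides \<open>M\<^sub>d\<close>,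
  the polynomial \<open>\<Sum>e | e dvd d. \<mu>(e) x ^ ((d div e) mod m)\<close> therefore vanishes, having degree
  less than \<open>m\<close>. Its derivative at 1 is congruent modulo \<open>m\<close> to
  \<open>(\<Sum>e | e dvd d. \<mu>(e) (d div e)) = \<phi>(d)\<close>.
\<close>

lemma prime_factors_prod_primes:
  fixes S :: "nat set"
  assumes "finite S" "\<And>p. p \<in> S \<Longrightarrow> prime p"
  shows "prime_factors (\<Prod>S) = S"
proof -
  have "0 \<notin> S"
    using assms(2) not_prime_0 by blast
  then have "prime_factors (\<Prod>S) = (\<Union>p\<in>S. prime_factors p)"
    using assms(1) prime_factors_prod[of S "\<lambda>p. p"] by (simp add: o_def)
  also have "\<dots> = S"
    using assms(2) by (auto simp: prime_factorization_prime)
  finally show ?thesis .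
qed

lemma prod_prime_factors_squarefree:
  fixes n :: nat
  assumes "squarefree n"
  shows "\<Prod>(prime_factors n) = n"
proof -
  have "n \<noteq> 0"
    using assms by (auto intro: Nat.gr0I)
  then have "n = (\<Prod>p\<in>prime_factors n. p ^ multiplicity p n)"
    by (simp add: prod_prime_factors)
  also have "\<dots> = \<Prod>(prime_factors n)"
    using assms \<open>n \<noteq> 0\<close> by (intro prod.cong) (auto simp: squarefree_factorial_semiring')
  finally show ?thesis by simp
qed

text \<open>By unique factorization \<open>prime_factors\<close> inverts \<open>Prod\<close> here.
  This turns the subset sum obtained from Euler's product into a sum over divisors.\<close>

lemma bij_betw_prod_squarefree_divisors:
  fixes n :: nat
  assumes "n > 0"
  shows "bij_betw Prod (Pow (prime_factors n)) {e. e dvd n \<and> squarefree e}"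
proof (rule bij_betw_byWitness[where f' = prime_factors])
  show "\<forall>S\<in>Pow (prime_factors n). prime_factors (\<Prod>S) = S"
    by (auto intro!: prime_factors_prod_primes intro: finite_subset)
  show "\<forall>e\<in>{e. e dvd n \<and> squarefree e}. \<Prod>(prime_factors e) = e"
    using prod_prime_factors_squarefree by blast
  show "Prod ` Pow (prime_factors n) \<subseteq> {e. e dvd n \<and> squarefree e}"
  proof safe
    fix S assume S: "S \<subseteq> prime_factors n"
    then have fin: "finite S" and prime: "\<And>p. p \<in> S \<Longrightarrow> prime p"
      by (auto intro: finite_subset)
    have coprime: "coprime p q" if "p \<in> S" "q \<in> S" "p \<noteq> q" for p q
      using that prime by (simp add: primes_coprime)
    \<comment> \<open>The radical of \<open>n\<close> serves as an intermediate divisor between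
      \<open>\<Prod>S\<close> and \<open>n\<close>.\<close>
    have "\<Prod>S dvd \<Prod>(prime_factors n)"
      using S by (intro prod_dvd_prod_subset) auto
    also have "\<dots> dvd (\<Prod>p\<in>prime_factors n. p ^ multiplicity p n)"
      by (intro prod_dvd_prod) (auto simp: prime_factors_multiplicity)
    also have "\<dots> = n"
      using assms by (simp add: prod_prime_factors)
    finally show "\<Prod>S dvd n" .
    show "squarefree (\<Prod>S)"
      using prime coprime by (intro squarefree_prod_coprime) (auto intro: squarefree_prime)
  qed
  show "prime_factors ` {e. e dvd n \<and> squarefree e} \<subseteq> Pow (prime_factors n)"
    using assms by (auto intro!: prime_factorsI intro: dvd_trans)
qed

text \<open>Expand Euler's product for the totient over the subsets \<open>S\<close> of the prime
  factors: the sign \<open>(-1) ^ card S\<close> is the Moebius value at the squarefree divisor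
  \<open>\<Prod>S\<close>, and divisors that are not squarefree contribute zero.\<close>

lemma totient_eq_sum_moebius_mu:
  assumes "n > 0"
  shows "int (totient n) = (\<Sum>e | e dvd n. moebius_mu e * int (n div e))"
proof -
  let ?P = "prime_factors n"
  have "real (totient n) = real n * (\<Prod>p\<in>?P. 1 - 1 / real p)"
    by (rule totient_formula2)
  also have "\<dots> = (\<Sum>S\<in>Pow ?P. (-1) ^ card S * (real n / real (\<Prod>S)))"
    by (simp add: prod_diff_conv_sum sum_distrib_left prod_dividef mult_ac)
  also have "\<dots> = (\<Sum>S\<in>Pow ?P. real_of_int (moebius_mu (\<Prod>S)) * (real n / real (\<Prod>S)))"
  proof (intro sum.cong refl)
    fix S assume S: "S \<in> Pow ?P"
    then have "squarefree (\<Prod>S)"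
      using bij_betwE[OF bij_betw_prod_squarefree_divisors[OF assms]] by blast
    moreover have "prime_factors (\<Prod>S) = S"
      using S by (intro prime_factors_prod_primes) (auto intro: finite_subset)
    ultimately show "(-1) ^ card S * (real n / real (\<Prod>S)) =
        real_of_int (moebius_mu (\<Prod>S)) * (real n / real (\<Prod>S))"
      by (simp add: moebius_mu_def)
  qed
  also have "\<dots> = (\<Sum>e | e dvd n \<and> squarefree e. real_of_int (moebius_mu e) * (real n / real e))"
    by (rule sum.reindex_bij_betw[OF bij_betw_prod_squarefree_divisors[OF assms]])
  also have "\<dots> = (\<Sum>e | e dvd n. real_of_int (moebius_mu e) * (real n / real e))"
    using assms by (intro sum.mono_neutral_left) (auto simp: moebius_mu_def)
  also have "\<dots> = real_of_int (\<Sum>e | e dvd n. moebius_mu e * int (n div e))"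
    by (auto simp: real_of_nat_div intro!: sum.cong)
  finally show ?thesis
    by linarith
qed

text \<open>With y = x^m and q = \<open>k div m\<close>, the difference is a multiple of y^q - 1,
  which y - 1 divides as in a geometric sum.\<close>

lemma monom_minus_1_dvd_monom_diff_mod:
  fixes c :: "'a :: comm_ring_1"
  shows "(monom 1 m - 1) dvd (monom c k - monom c (k mod m))"
proof -
  have "monom 1 m - 1 dvd (monom 1 m :: 'a poly) ^ (k div m) - 1"
    by (simp add: power_diff_1_eq)
  moreover have "monom c k - monom c (k mod m) =
      monom c (k mod m) * ((monom 1 m) ^ (k div m) - 1)"
    by (simp add: monom_power mult_monom algebra_simps)
  ultimately show ?thesis
    by simp
qed

theorem theorem2p14:
  fixes m d :: nat
  assumes "m \<ge> 1" and "d \<ge> 1"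
    and "(monom 1 m - 1 :: rat poly) dvd necklace_poly d"
  shows "m dvd totient d"
proof -
  define \<mu> where "\<mu> = (\<lambda>e. of_int (moebius_mu e) :: rat)"
  define R where "R = (\<Sum>e | e dvd d. monom (\<mu> e) (d div e mod m))"
  have "monom 1 m - 1 dvd (\<Sum>e | e dvd d. monom (\<mu> e) (d div e))"
    using assms by (simp add: necklace_poly_def \<mu>_def dvd_smult_iff)
  moreover have "monom 1 m - 1 dvd (\<Sum>e | e dvd d. monom (\<mu> e) (d div e)) - R"
    unfolding R_def sum_subtractf[symmetric]
    by (intro dvd_sum monom_minus_1_dvd_monom_diff_mod)
  ultimately have dvd: "monom 1 m - 1 dvd R"
    by (simp add: dvd_diff_right_iff)
  have deg: "m \<le> degree (monom 1 m - 1 :: rat poly)"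
    using assms(1) by (intro le_degree) auto
  have "degree R < m"
    unfolding R_def using assms(1)
    by (intro degree_sum_less) (auto intro: le_less_trans[OF degree_monom_le])
  \<comment> \<open>A nonzero multiple of x^m - 1 would have degree at least
    \<open>m\<close>.\<close>
  with dvd deg have "R = 0"
    by (meson dvd_imp_degree_le leD order_trans)
  \<comment> \<open>Differentiating and evaluating at 1 turns each exponent into an integer weight;
    a zero exponent correctly gets weight 0.\<close>
  then have "0 = poly (pderiv R) 1"
    by simp
  also have "\<dots> = of_int (\<Sum>e | e dvd d. moebius_mu e * int (d div e mod m))"
    unfolding R_def by (simp add: higher_pderiv_sum[of 1, simplified] pderiv_monom poly_sum poly_monom \<mu>_def mult.commute)
  \<comment> \<open>The vanishing must be moved from the rationals to the integers, where congruence
    modulo \<open>m\<close> is meaningful.\<close>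
  finally have "(\<Sum>e | e dvd d. moebius_mu e * int (d div e mod m)) = 0"
    by (metis of_int_eq_0_iff)
  moreover have "[(\<Sum>e | e dvd d. moebius_mu e * int (d div e)) =
      (\<Sum>e | e dvd d. moebius_mu e * int (d div e mod m))] (mod int m)"
    by (intro cong_sum cong_mult cong_refl) (simp add: cong_def zmod_int)
  ultimately have "[int (totient d) = 0] (mod int m)"
    using assms(2) by (simp add: totient_eq_sum_moebius_mu)
  then show ?thesis
    by (simp add: cong_0_iff)
qed

end
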